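(* Let $X$ be an L-space and let $Y=\{x\in X: {\downarrow}x \text{ is clopen}\}$, equipped with the subspace topology induced by the topology of open upsets of $X$. Then the poset $\mathsf{SUp}(X)$ of S-upsets of $X$, ordered by inclusion, is isomorphic to the poset $\mathsf{KSat}(Y)$ of compact saturated subsets of $Y$, ordered by inclusion. (The isomorphism is $K\mapsto K\cap Y$ with inverse $Q\mapsto{\uparrow}Q$.)
   Context: A Priestley space is a compact Hausdorff zero-dimensional space $X$ with a partial order $\le$ such that whenever $x\not\le y$ there is a clopen upset $U$ with $x\in U$, $y\notin U$. For $S\subseteq X$, ${\uparrow}S=\{x: s\le x\text{ for some } s\in S\}$ and ${\downarrow}S=\{x: x\le s\text{ for some } s\in S\}$. An Esakia space is a Priestley space in which ${\downarrow}U$ is clopen for each clopen $U$. An L-space (localic space) is an Esakia space in which the closure of every open upset is open. For $K\subseteq X$, $\min K$ is the set of minimal elements of $K$. An S-upset of $X$ is a closed upset $K$ of $X$ with $\min K\subseteq Y$. A subset of a topological space is saturated if it is an upset in the specialization order ($x\le y$ iff $x$ lies in the closure of $\{y\}$). *)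

theory Defs
  imports "HOL-Analysis.Analysis"
begin

section \<open>Upsets and downsets\<close>

text \<open>
  An order \<open>x \<le> y\<close> on the points of a space is represented by a relation \<open>r\<close> with
  \<open>(x, y) \<in> r\<close>. It is contained in the square of the underlying set (see
  \<open>partial_order_on\<close> below), so \<open>up\<close> and \<open>down\<close> never leave that set.
\<close>

abbreviation up :: "'a rel \<Rightarrow> 'a set \<Rightarrow> 'a set" where
  "up r S \<equiv> r `` S"

abbreviation down :: "'a rel \<Rightarrow> 'a set \<Rightarrow> 'a set" where
  "down r S \<equiv> r\<inverse> `` S"

definition upset :: "'a rel \<Rightarrow> 'a set \<Rightarrow> bool" where
  "upset r S \<longleftrightarrow> (\<forall>x y. x \<in> S \<longrightarrow> (x, y) \<in> r \<longrightarrow> y \<in> S)"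

definition minimals :: "'a rel \<Rightarrow> 'a set \<Rightarrow> 'a set" where
  "minimals r K = {x \<in> K. \<forall>y\<in>K. (y, x) \<in> r \<longrightarrow> y = x}"


section \<open>Priestley spaces, Esakia spaces and L-spaces\<close>

definition clopenin :: "'a topology \<Rightarrow> 'a set \<Rightarrow> bool" where
  "clopenin X U \<longleftrightarrow> closedin X U \<and> openin X U"

text \<open>The clopen sets form a base of the topology.\<close>

definition zero_dimensional_space :: "'a topology \<Rightarrow> bool" where
  "zero_dimensional_space X \<longleftrightarrow> openin X = arbitrary union_of (clopenin X)"

locale Priestley_space =
  fixes X :: "'a topology" and r :: "'a rel"
  assumes compact: "compact_space X"
    and Hausdorff: "Hausdorff_space X"
    and zero_dimensional: "zero_dimensional_space X"
    and partial_order: "partial_order_on (topspace X) r"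
    and separation: "\<lbrakk>x \<in> topspace X; y \<in> topspace X; (x, y) \<notin> r\<rbrakk>
      \<Longrightarrow> \<exists>U. clopenin X U \<and> upset r U \<and> x \<in> U \<and> y \<notin> U"

locale Esakia_space = Priestley_space +
  assumes clopenin_down: "clopenin X U \<Longrightarrow> clopenin X (down r U)"

locale L_space = Esakia_space +
  assumes openin_closure_of_upset:
    "\<lbrakk>openin X U; upset r U\<rbrakk> \<Longrightarrow> openin X (X closure_of U)"


section \<open>S-upsets and the space of localic points\<close>

definition localic_part :: "'a topology \<Rightarrow> 'a rel \<Rightarrow> 'a set" where
  "localic_part X r = {x \<in> topspace X. clopenin X (down r {x})}"

definition S_upsets :: "'a topology \<Rightarrow> 'a rel \<Rightarrow> 'a set set" where
  "S_upsets X r = {K. closedin X K \<and> upset r K \<and> minimals r K \<subseteq> localic_part X r}"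

definition open_upset_topology :: "'a topology \<Rightarrow> 'a rel \<Rightarrow> 'a topology" where
  "open_upset_topology X r = topology (\<lambda>U. openin X U \<and> upset r U)"

lemma openin_open_upset_topology:
  "openin (open_upset_topology X r) U \<longleftrightarrow> openin X U \<and> upset r U"
proof -
  have "istopology (\<lambda>U. openin X U \<and> upset r U)"
    unfolding istopology_def upset_def by (auto; blast)
  then show ?thesis
    by (simp add: open_upset_topology_def topology_inverse')
qed

definition localic_space :: "'a topology \<Rightarrow> 'a rel \<Rightarrow> 'a topology" where
  "localic_space X r = subtopology (open_upset_topology X r) (localic_part X r)"


section \<open>Compact saturated sets\<close>

definition specialization :: "'a topology \<Rightarrow> 'a rel" where
  "specialization Z = {(x, y). y \<in> topspace Z \<and> x \<in> Z closure_of {y}}"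

definition saturatedin :: "'a topology \<Rightarrow> 'a set \<Rightarrow> bool" where
  "saturatedin Z S \<longleftrightarrow> S \<subseteq> topspace Z \<and> upset (specialization Z) S"

definition KSat :: "'a topology \<Rightarrow> 'a set set" where
  "KSat Z = {Q. compactin Z Q \<and> saturatedin Z Q}"


section \<open>Isomorphisms of posets\<close>

definition poset_isomorphism ::
  "'a set \<Rightarrow> ('a \<Rightarrow> 'a \<Rightarrow> bool) \<Rightarrow> 'b set \<Rightarrow> ('b \<Rightarrow> 'b \<Rightarrow> bool) \<Rightarrow> ('a \<Rightarrow> 'b) \<Rightarrow> bool" where
  "poset_isomorphism A leA B leB f \<longleftrightarrow>
    bij_betw f A B \<and> (\<forall>x\<in>A. \<forall>y\<in>A. leA x y \<longleftrightarrow> leB (f x) (f y))"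

end

theory Submission
  imports Defs
begin

text \<open>
  In a Priestley space every point of a closed set \<open>K\<close> lies above a minimal point of \<open>K\<close>, so an
  S-upset is generated by its localic points, and covers of these by open upsets are already
  covers of the compact set \<open>K\<close>. Conversely, by Priestley separation, a set that is compact in the
  topology of open upsets generates an intersection of clopen upsets, hence a closed upset.
  Saturation in the localic part means being an upset there, since separation identifies the
  specialization order with the given order.
\<close>

context Priestley_space
begin

section \<open>Order, closed sets and minimal points in a Priestley space\<close>

lemma r_refl: "x \<in> topspace X \<Longrightarrow> (x, x) \<in> r"
  using partial_order by (auto simp: partial_order_on_def preorder_on_def refl_on_def)

lemma r_trans: "(x, y) \<in> r \<Longrightarrow> (y, z) \<in> r \<Longrightarrow> (x, z) \<in> r"
  using partial_order by (auto simp: partial_order_on_def preorder_on_def dest: transD)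

lemma r_antisym: "(x, y) \<in> r \<Longrightarrow> (y, x) \<in> r \<Longrightarrow> x = y"
  using partial_order by (auto simp: partial_order_on_def dest: antisymD)

lemma in_topspace:
  assumes "(x, y) \<in> r"
  shows "x \<in> topspace X" "y \<in> topspace X"
  using assms partial_order by (auto simp: partial_order_on_def preorder_on_def)

lemma upset_up: "upset r (up r S)"
  unfolding upset_def by (blast intro: r_trans)

lemma subset_up: "S \<subseteq> topspace X \<Longrightarrow> S \<subseteq> up r S"
  using r_refl by blast

lemma up_subset_upset: "upset r U \<Longrightarrow> S \<subseteq> U \<Longrightarrow> up r S \<subseteq> U"
  unfolding upset_def by blast

text \<open>An upset avoiding \<open>c\<close> misses everything below \<open>c\<close>, so the
  clopen upsets given by separation are neighbourhoods inside the complement.\<close>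

lemma closedin_down_singleton: "closedin X (down r {c})"
proof (cases "c \<in> topspace X")
  case True
  have "openin X (topspace X - down r {c})"
  proof (subst openin_subopen, intro ballI)
    fix y
    assume "y \<in> topspace X - down r {c}"
    then obtain U where "clopenin X U" "upset r U" "y \<in> U" "c \<notin> U"
      using True separation[of y c] by auto
    then show "\<exists>T. openin X T \<and> y \<in> T \<and> T \<subseteq> topspace X - down r {c}"
      by (intro exI[of _ U]) (auto simp: clopenin_def upset_def dest: openin_subset)
  qed
  then show ?thesis
    using in_topspace by (auto simp: closedin_def)
next
  case False
  then have "down r {c} = {}"
    using in_topspace by blast
  then show ?thesis
    by simp
qed

text \<open>Zorn's lemma applies to the part of \<open>K\<close> below \<open>x\<close>: a nonempty
  chain there has a lower bound because the closed sets \<open>K \<inter> down r {c}\<close>, with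
  \<open>c\<close> in the chain, have the finite intersection property and the space is
  compact.\<close>

lemma minimal_below:
  assumes K: "closedin X K" and x: "x \<in> K"
  obtains m where "m \<in> minimals r K" "(m, x) \<in> r"
proof -
  define A where "A = K \<inter> down r {x}"
  have K_sub: "K \<subseteq> topspace X"
    using K by (rule closedin_subset)
  have xA: "x \<in> A"
    using x K_sub r_refl by (auto simp: A_def)
  have "\<exists>m\<in>A. \<forall>a\<in>A. (a, m) \<in> r \<longrightarrow> a = m"
  \<comment> \<open>The order is reversed because \<open>predicate_Zorn\<close> yields maximal
    elements.\<close>
  proof (rule predicate_Zorn[where P = "\<lambda>a b. (b, a) \<in> r"])
    show "partial_order_on A (relation_of (\<lambda>a b. (b, a) \<in> r) A)"
    proof (rule partial_order_on_relation_ofI)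
      show "(a, a) \<in> r" if "a \<in> A" for a
        using that K_sub r_refl by (auto simp: A_def)
    qed (blast intro: r_trans r_antisym)+
  next
    fix C
    assume "C \<in> Chains (relation_of (\<lambda>a b. (b, a) \<in> r) A)"
    then have CA: "C \<subseteq> A" and chain: "\<And>a b. a \<in> C \<Longrightarrow> b \<in> C \<Longrightarrow> (a, b) \<in> r \<or> (b, a) \<in> r"
      by (auto simp: Chains_def relation_of_def)
    show "\<exists>u\<in>A. \<forall>a\<in>C. (u, a) \<in> r"
    proof (cases "C = {}")
      case True
      then show ?thesis
        using xA by blast
    next
      case False
      \<comment> \<open>The least element of a finite part \<open>D\<close> of the chain will lie in
        every \<open>K \<inter> down r {c}\<close> with \<open>c\<close> in
        \<open>D\<close>.\<close>
      have least: "\<exists>b\<in>D. \<forall>a\<in>D. (b, a) \<in> r" if "finite D" "D \<noteq> {}" "D \<subseteq> C" for D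
        using that
      proof (induction D rule: finite_ne_induct)
        case (singleton a)
        then show ?case
          using CA K_sub r_refl by (auto simp: A_def)
      next
        case (insert a D)
        then obtain b where b: "b \<in> D" "\<forall>a\<in>D. (b, a) \<in> r"
          by auto
        have a: "a \<in> C" "(a, a) \<in> r"
          using insert.prems CA K_sub r_refl by (auto simp: A_def)
        have "(a, b) \<in> r \<or> (b, a) \<in> r"
          using chain a b insert.prems by blast
        then show ?case
          using a b by (blast intro: r_trans)
      qed
      let ?F = "(\<lambda>c. K \<inter> down r {c}) ` C"
      have "\<Inter>?F \<noteq> {}"
      proof (rule compact_space_fip[THEN iffD1, rule_format, OF compact], intro conjI ballI allI impI)
        show "closedin X S" if "S \<in> ?F" for S
          using that K closedin_down_singleton by auto
      next
        fix G
        assume G: "finite G \<and> G \<subseteq> ?F"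
        show "\<Inter>G \<noteq> {}"
        proof -
          obtain D where D: "D \<subseteq> C" "finite D" "G = (\<lambda>c. K \<inter> down r {c}) ` D"
            using G finite_subset_image by metis
          show ?thesis
          proof (cases "D = {}")
            case False
            then obtain b where b: "b \<in> D" "\<forall>a\<in>D. (b, a) \<in> r"
              using least D by blast
            then have "b \<in> \<Inter>G"
              using D CA by (auto simp: A_def)
            then show ?thesis
              by blast
          \<comment> \<open>For empty \<open>D\<close> the intersection is
            \<open>\<Inter>{} = UNIV\<close>.\<close>
          qed (use D in auto)
        qed
      qed
      then obtain u where u: "u \<in> \<Inter>?F"
        by blast
      \<comment> \<open>Some \<open>c\<close> in the nonempty chain gives both \<open>u\<close> in
        \<open>K\<close> and \<open>u\<close> below \<open>c\<close>, hence below
        \<open>x\<close>.\<close>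
      moreover have "u \<in> A"
        using u False CA by (auto simp: A_def intro: r_trans)
      ultimately show ?thesis
        by blast
    qed
  qed
  then obtain m where m: "m \<in> A" "\<forall>a\<in>A. (a, m) \<in> r \<longrightarrow> a = m"
    by blast
  \<comment> \<open>Any point of \<open>K\<close> below \<open>m\<close> is also below
    \<open>x\<close>, so it belongs to \<open>A\<close>.\<close>
  then have "m \<in> minimals r K"
    by (auto simp: A_def minimals_def intro: r_trans)
  then show thesis
    using that m by (auto simp: A_def)
qed

section \<open>Open upsets and the localic part\<close>

lemma topspace_open_upset_topology: "topspace (open_upset_topology X r) = topspace X"
proof -
  have "openin (open_upset_topology X r) (topspace X)"
    by (auto simp: openin_open_upset_topology upset_def dest: in_topspace)
  then show ?thesis
    by (metis openin_open_upset_topology openin_subset openin_topspace subset_antisym)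
qed

lemma localic_part_subset: "localic_part X r \<subseteq> topspace X"
  by (auto simp: localic_part_def)

lemma topspace_localic_space: "topspace (localic_space X r) = localic_part X r"
  using localic_part_subset
  by (auto simp: localic_space_def topspace_open_upset_topology)

lemma specialization_localic_space:
  "specialization (localic_space X r) = r \<inter> localic_part X r \<times> localic_part X r"
    (is "?S = r \<inter> ?Y \<times> ?Y")
proof -
  have "(x, y) \<in> ?S \<longleftrightarrow> (x, y) \<in> r" if xy: "x \<in> ?Y" "y \<in> ?Y" for x y
  proof -
    \<comment> \<open>Open sets of the subspace are traces of open upsets on \<open>?Y\<close>; for
      \<open>x\<close> and \<open>y\<close> in \<open>?Y\<close> membership in the trace is
      membership in the upset.\<close>
    have "(x, y) \<in> ?S \<longleftrightarrow> (\<forall>U. openin X U \<and> upset r U \<and> x \<in> U \<longrightarrow> y \<in> U)"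
      using xy
      unfolding specialization_def in_closure_of topspace_localic_space
      by (auto simp: localic_space_def openin_subtopology openin_open_upset_topology)
    also have "\<dots> \<longleftrightarrow> (x, y) \<in> r"
      using xy localic_part_subset separation[of x y]
      by (auto simp: clopenin_def upset_def)
    finally show ?thesis .
  qed
  moreover have "?S \<subseteq> ?Y \<times> ?Y"
    using closure_of_subset_topspace[of "localic_space X r"]
    by (auto simp: specialization_def topspace_localic_space)
  ultimately show ?thesis
    by auto
qed

text \<open>Compactness moves to the ambient topology of open upsets, and saturation takes the form
  of one of the two inverse laws of the isomorphism.\<close>

lemma mem_KSat_iff:
  "Q \<in> KSat (localic_space X r) \<longleftrightarrow>
    compactin (open_upset_topology X r) Q \<and> Q \<subseteq> localic_part X r \<and> up r Q \<inter> localic_part X r = Q"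
proof -
  have "upset (specialization (localic_space X r)) Q \<longleftrightarrow> up r Q \<inter> localic_part X r = Q"
    if "Q \<subseteq> localic_part X r"
    using that subset_up[of Q] localic_part_subset
    unfolding upset_def specialization_localic_space by blast
  then show ?thesis
    using localic_part_subset
    by (auto simp: KSat_def saturatedin_def topspace_localic_space localic_space_def
        compactin_subtopology topspace_open_upset_topology)
qed

section \<open>The two mutually inverse maps\<close>

lemma up_S_upset:
  assumes "K \<in> S_upsets X r"
  shows "up r (K \<inter> localic_part X r) = K"
proof
  show "up r (K \<inter> localic_part X r) \<subseteq> K"
    using assms by (intro up_subset_upset) (auto simp: S_upsets_def)
  show "K \<subseteq> up r (K \<inter> localic_part X r)"
  proof
    fix x
    assume "x \<in> K"
    then obtain m where "m \<in> minimals r K" "(m, x) \<in> r"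
      using assms minimal_below by (auto simp: S_upsets_def)
    then show "x \<in> up r (K \<inter> localic_part X r)"
      using assms by (auto simp: S_upsets_def minimals_def)
  qed
qed

lemma S_upset_Int_localic_part:
  assumes "K \<in> S_upsets X r"
  shows "K \<inter> localic_part X r \<in> KSat (localic_space X r)"
proof -
  let ?Y = "localic_part X r"
  have K: "compactin X K"
    using assms compact closedin_compact_space by (auto simp: S_upsets_def)
  have "compactin (open_upset_topology X r) (K \<inter> ?Y)"
    unfolding compactin_def
  proof (intro conjI allI impI)
    show "K \<inter> ?Y \<subseteq> topspace (open_upset_topology X r)"
      using localic_part_subset by (auto simp: topspace_open_upset_topology)
    fix \<U>
    assume \<U>: "Ball \<U> (openin (open_upset_topology X r)) \<and> K \<inter> ?Y \<subseteq> \<Union>\<U>"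
    then have "upset r (\<Union>\<U>)"
      by (auto simp: openin_open_upset_topology upset_def)
    \<comment> \<open>An upset containing \<open>K \<inter> ?Y\<close> contains the upset it
      generates, which is \<open>K\<close>.\<close>
    then have "K \<subseteq> \<Union>\<U>"
      using up_subset_upset up_S_upset[OF assms] \<U> by metis
    then show "\<exists>\<F>. finite \<F> \<and> \<F> \<subseteq> \<U> \<and> K \<inter> ?Y \<subseteq> \<Union>\<F>"
      using compactinD[OF K, of \<U>] \<U> by (auto simp: openin_open_upset_topology)
  qed
  then show ?thesis
    by (simp add: mem_KSat_iff up_S_upset[OF assms])
qed

lemma closedin_up_compactin:
  assumes Q: "compactin (open_upset_topology X r) Q"
  shows "closedin X (up r Q)"
proof -
  have Q_sub: "Q \<subseteq> topspace X"
    using compactin_subset_topspace[OF Q] by (simp add: topspace_open_upset_topology)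
  have "openin X (topspace X - up r Q)"
  proof (subst openin_subopen, intro ballI)
    fix y
    assume y: "y \<in> topspace X - up r Q"
    \<comment> \<open>Clopen members serve twice: being open they can cover \<open>Q\<close>, and
      being closed they have closed finite unions, whose complement is a neighbourhood of
      \<open>y\<close>.\<close>
    let ?\<U> = "{U. clopenin X U \<and> upset r U \<and> y \<notin> U}"
    have "Q \<subseteq> \<Union>?\<U>"
    proof
      fix x
      assume "x \<in> Q"
      then show "x \<in> \<Union>?\<U>"
        using y Q_sub separation[of x y] by blast
    qed
    then obtain \<F> where \<F>: "finite \<F>" "\<F> \<subseteq> ?\<U>" "Q \<subseteq> \<Union>\<F>"
      using compactinD[OF Q, of ?\<U>] by (auto simp: clopenin_def openin_open_upset_topology)
    have "up r Q \<subseteq> \<Union>\<F>"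
      using \<F> by (intro up_subset_upset) (auto simp: upset_def)
    moreover have "closedin X (\<Union>\<F>)"
      using \<F> by (intro closedin_Union) (auto simp: clopenin_def)
    ultimately show "\<exists>T. openin X T \<and> y \<in> T \<and> T \<subseteq> topspace X - up r Q"
      using y \<F> by (intro exI[of _ "topspace X - \<Union>\<F>"]) auto
  qed
  then show ?thesis
    using in_topspace by (auto simp: closedin_def)
qed

lemma up_KSat:
  assumes "Q \<in> KSat (localic_space X r)"
  shows "up r Q \<in> S_upsets X r"
proof -
  have "compactin (open_upset_topology X r) Q" and Y: "Q \<subseteq> localic_part X r"
    using assms by (auto simp: mem_KSat_iff)
  \<comment> \<open>A minimal point of \<open>up r Q\<close> lies above some point of
    \<open>Q\<close>, itself in \<open>up r Q\<close>, and so equals it.\<close>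
  moreover have "minimals r (up r Q) \<subseteq> Q"
    using subset_up[OF subset_trans[OF Y localic_part_subset]] by (auto simp: minimals_def)
  ultimately show ?thesis
    using closedin_up_compactin upset_up by (auto simp: S_upsets_def)
qed

lemma up_KSat_Int_localic_part:
  "Q \<in> KSat (localic_space X r) \<Longrightarrow> up r Q \<inter> localic_part X r = Q"
  by (simp add: mem_KSat_iff)

end

theorem theorem5p7:
  fixes X :: "'a topology" and r :: "'a rel"
  assumes "L_space X r"
  shows "poset_isomorphism
      (S_upsets X r) (\<subseteq>) (KSat (localic_space X r)) (\<subseteq>) (\<lambda>K. K \<inter> localic_part X r)
    \<and> (\<forall>Q\<in>KSat (localic_space X r).
          up r Q \<in> S_upsets X r \<and> up r Q \<inter> localic_part X r = Q)
    \<and> (\<forall>K\<in>S_upsets X r. up r (K \<inter> localic_part X r) = K)"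
proof -
  interpret L_space X r
    by fact
  let ?f = "\<lambda>K. K \<inter> localic_part X r"
  have "bij_betw ?f (S_upsets X r) (KSat (localic_space X r))"
    by (rule bij_betw_byWitness[where f' = "up r"])
      (use up_S_upset up_KSat_Int_localic_part S_upset_Int_localic_part up_KSat in auto)
  \<comment> \<open>The order is reflected because \<open>up r\<close> is monotone and recovers
    \<open>K\<close> and \<open>L\<close> from their traces.\<close>
  moreover have "K \<subseteq> L \<longleftrightarrow> ?f K \<subseteq> ?f L" if "K \<in> S_upsets X r" "L \<in> S_upsets X r" for K L
    using up_S_upset[OF that(1)] up_S_upset[OF that(2)] by blast
  ultimately show ?thesis
    using up_S_upset up_KSat up_KSat_Int_localic_part
    by (simp add: poset_isomorphism_def)
qed

end
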